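(* Let $G=(V,E)$, $V=T\sqcup S$, be a directed 2-layer Clos network with unit link capacities, and let $C$ be a finite collection of commodities on $G$ with demands in $\{0,1\}$, at least one of which has demand $1$, partitioned into subcollections $(C_j)_{j\in J}$ indexed by training jobs. Then $Greedy$ is a $2$-approximation for the $2$-layered max-min fairness objective. That is, for every order in which $Greedy$ processes the commodities, if $P^{Gr}$ is the path assignment output by $Greedy$, then for every path assignment $P$, $$\min_{j\in J}\ \min_{c\in C_j} b_c(P^{Gr})\ \ge\ \frac12\,\min_{j\in J}\ \min_{c\in C_j} b_c(P),$$ where the minima range over commodities of demand $1$, and $b_c(\cdot)$ is the bandwidth share of commodity $c$ induced by the path assignment.
   Context: **Network.** A directed 2-layer Clos network is a graph $G=(V,E)$ whose vertex set is the disjoint union of two finite nonempty sets $T$ (top-of-rack switches, ToRs) and $S$ (spine switches). It is a full bipartite graph with bidirectional links: for all $t\in T$, $s\in S$, both directed links $(t,s)$ and $(s,t)$ are in $E$, and there are no other links. Every directed link has capacity $1$. **Commodities.** $C$ is a finite collection of commodities (several commodities may have the same endpoints). Each commodity $c$ is of the form $(u,v)\in T^2$ with $u\neq v$ (source $u$, destination $v$) and has a demand $d_c\in\{0,1\}$; commodities with demand $0$ carry no traffic. $C$ is the disjoint union of subcollections $C_j$, $j\in J$, one for each training job. Hence $\min_{j\in J}\min_{c\in C_j} b_c=\min_{c\in C}b_c$ (over demand-$1$ commodities). **Path assignments and congestion.** For $u\ne v$ in $T$, $P_{uv}$ denotes the set of shortest directed paths from $u$ to $v$ in $G$, i.e.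 the $|S|$ paths $u\to s\to v$ with $s\in S$. A path assignment maps every commodity $c=(u,v)$ to a single path in $P_{uv}$. Given an assignment (of some or all of the commodities), the congestion of a link is the aggregate demand of the commodities whose assigned paths traverse it, i.e. the number of assigned paths of demand-$1$ commodities traversing it. The congestion of a path is the maximum congestion of its two links. **Bandwidth shares.** A path assignment $P$ induces bandwidth shares $b_c(P)\ge 0$ for the demand-$1$ commodities, namely the (unique) max-min fair rate allocation (the equilibrium of congestion control). A rate vector $b$ is feasible if for every link $e$ the sum of $b_c$ over the demand-$1$ commodities whose assigned path traverses $e$ is at most $1$. A feasible $b$ is max-min fair if in any feasible $b'$ with $b'_c>b_c$ for some $c$, there is a commodity $c'$ with $b_{c'}\le b_c$ and $b'_{c'}<b_{c'}$. **The $2$-layered max-min fairness objective** is to choose a path assignment $P$ maximizing $\min_{j\in J}\min_{c\in C_j}b_c(P)$. **Algorithm $Greedy$.** Process the commodities of $C$ one by one in an arbitrary order. Assign each commodity $c=(u,v)$ to a path in $P_{uv}$ whose congestion, with respect to the commodities assigned so far, is minimum among all paths in $P_{uv}$ (ties broken arbitrarily). *)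

theory Defs
  imports Complex_Main "HOL-Library.Disjoint_Sets" "Graph_Theory.Arc_Walk"
begin

definition clos_network :: "'v set \<Rightarrow> 'v set \<Rightarrow> ('v, 'v \<times> 'v) pre_digraph" where
  "clos_network T S =
     \<lparr>verts = T \<union> S, arcs = T \<times> S \<union> S \<times> T, tail = fst, head = snd\<rparr>"

text \<open>Paths are lists of links, so \<open>set p\<close> is the set of links traversed by \<open>p\<close>.\<close>

definition shortest_paths :: "('v, 'e) pre_digraph \<Rightarrow> 'v \<Rightarrow> 'v \<Rightarrow> 'e list set" where
  "shortest_paths G u v =
     {p. pre_digraph.apath G u p v \<and> (\<forall>q. pre_digraph.apath G u q v \<longrightarrow> length p \<le> length q)}"

lemma shortest_paths_clos_network:
  assumes "T \<inter> S = {}" "S \<noteq> {}" "u \<in> T" "v \<in> T" "u \<noteq> v"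
  shows "shortest_paths (clos_network T S) u v = (\<lambda>s. [(u, s), (s, v)]) ` S"
proof -
  let ?G = "clos_network T S"
  have two: "pre_digraph.apath ?G u [(u, s), (s, v)] v" if "s \<in> S" for s
    using assms that
    by (auto simp: pre_digraph.apath_def pre_digraph.awalk_def pre_digraph.cas.simps
        pre_digraph.awalk_verts.simps clos_network_def)
  have ge: "2 \<le> length q" if "pre_digraph.apath ?G u q v" for q
  proof (rule ccontr)
    assume "\<not> 2 \<le> length q"
    then have "q = [] \<or> (\<exists>e. q = [e])"
      by (cases q; cases "tl q") auto
    then show False using assms that
      by (auto simp: pre_digraph.apath_def pre_digraph.awalk_def pre_digraph.cas.simps
          clos_network_def)
  qed
  have form: "q \<in> (\<lambda>s. [(u, s), (s, v)]) ` S"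
    if q: "pre_digraph.apath ?G u q v" "length q \<le> 2" for q
  proof -
    obtain e f where "q = [e, f]"
      using ge[OF q(1)] q(2) by (cases q; cases "tl q"; cases "tl (tl q)") auto
    then show ?thesis using assms q
      by (auto simp: pre_digraph.apath_def pre_digraph.awalk_def pre_digraph.cas.simps
          clos_network_def)
  qed
  obtain s0 where "s0 \<in> S" using assms by blast
  show ?thesis
  proof
    show "shortest_paths ?G u v \<subseteq> (\<lambda>s. [(u, s), (s, v)]) ` S"
    proof
      fix q assume "q \<in> shortest_paths ?G u v"
      then have "pre_digraph.apath ?G u q v" "length q \<le> length [(u, s0), (s0, v)]"
        using two[OF \<open>s0 \<in> S\<close>] unfolding shortest_paths_def by blast+
      then show "q \<in> (\<lambda>s. [(u, s), (s, v)]) ` S" by (intro form) auto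
    qed
    show "(\<lambda>s. [(u, s), (s, v)]) ` S \<subseteq> shortest_paths ?G u v"
      using two ge by (auto simp: shortest_paths_def numeral_2_eq_2)
  qed
qed

type_synonym ('c, 'e) assignment = "'c \<rightharpoonup> 'e list"

definition path_assignment ::
  "('v, 'e) pre_digraph \<Rightarrow> 'c set \<Rightarrow> ('c \<Rightarrow> 'v) \<Rightarrow> ('c \<Rightarrow> 'v) \<Rightarrow> ('c, 'e) assignment \<Rightarrow> bool" where
  "path_assignment G C src dst A \<longleftrightarrow>
     dom A = C \<and> (\<forall>c\<in>C. the (A c) \<in> shortest_paths G (src c) (dst c))"

definition traversing :: "('c, 'e) assignment \<Rightarrow> 'e \<Rightarrow> 'c set" where
  "traversing A e = {c. \<exists>p. A c = Some p \<and> e \<in> set p}"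

definition congestion :: "('c \<Rightarrow> nat) \<Rightarrow> ('c, 'e) assignment \<Rightarrow> 'e \<Rightarrow> nat" where
  "congestion d A e = (\<Sum>c\<in>traversing A e. d c)"

definition path_congestion :: "('c \<Rightarrow> nat) \<Rightarrow> ('c, 'e) assignment \<Rightarrow> 'e list \<Rightarrow> nat" where
  "path_congestion d A p = Max (congestion d A ` set p)"

text \<open>\<open>greedy_run G src dst d cs A\<close>: processing the commodities in the order \<open>cs\<close>, starting
  from the empty assignment, the algorithm can end (for some way of breaking ties) with \<open>A\<close>.\<close>

inductive greedy_run ::
  "('v, 'e) pre_digraph \<Rightarrow> ('c \<Rightarrow> 'v) \<Rightarrow> ('c \<Rightarrow> 'v) \<Rightarrow> ('c \<Rightarrow> nat) \<Rightarrow>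
    'c list \<Rightarrow> ('c, 'e) assignment \<Rightarrow> bool"
  for G src dst d where
  start: "greedy_run G src dst d [] Map.empty"
| assign: "greedy_run G src dst d cs A \<Longrightarrow>
    is_arg_min (path_congestion d A) (\<lambda>p. p \<in> shortest_paths G (src c) (dst c)) p \<Longrightarrow>
    greedy_run G src dst d (cs @ [c]) (A(c \<mapsto> p))"

text \<open>Rates are only meaningful for demand-1 commodities. They are set to \<open>0\<close> everywhere else,
  so that the max-min fair rate vector is unique as a total function.\<close>

definition active :: "('c \<Rightarrow> nat) \<Rightarrow> ('c, 'e) assignment \<Rightarrow> 'c set" where
  "active d A = {c \<in> dom A. d c = 1}"

definition feasible_rates ::
  "('v, 'e) pre_digraph \<Rightarrow> ('c \<Rightarrow> nat) \<Rightarrow> ('c, 'e) assignment \<Rightarrow> ('c \<Rightarrow> real) \<Rightarrow> bool" where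
  "feasible_rates G d A b \<longleftrightarrow>
     (\<forall>c\<in>active d A. 0 \<le> b c) \<and> (\<forall>c. c \<notin> active d A \<longrightarrow> b c = 0) \<and>
     (\<forall>e\<in>arcs G. (\<Sum>c\<in>active d A \<inter> traversing A e. b c) \<le> 1)"

definition max_min_fair ::
  "('v, 'e) pre_digraph \<Rightarrow> ('c \<Rightarrow> nat) \<Rightarrow> ('c, 'e) assignment \<Rightarrow> ('c \<Rightarrow> real) \<Rightarrow> bool" where
  "max_min_fair G d A b \<longleftrightarrow> feasible_rates G d A b \<and>
     (\<forall>b'. feasible_rates G d A b' \<longrightarrow>
       (\<forall>c\<in>active d A. b' c > b c \<longrightarrow> (\<exists>c'\<in>active d A. b c' \<le> b c \<and> b' c' < b c')))"

definition bandwidth_share ::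
  "('v, 'e) pre_digraph \<Rightarrow> ('c \<Rightarrow> nat) \<Rightarrow> ('c, 'e) assignment \<Rightarrow> 'c \<Rightarrow> real" where
  "bandwidth_share G d A = (THE b. max_min_fair G d A b)"

text \<open>Jobs without any demand-1 commodity do not contribute to the outer minimum.\<close>

definition min_job_share :: "'j set \<Rightarrow> ('j \<Rightarrow> 'c set) \<Rightarrow> ('c \<Rightarrow> nat) \<Rightarrow> ('c \<Rightarrow> real) \<Rightarrow> real" where
  "min_job_share J Cj d b =
     Min ((\<lambda>j. Min (b ` {c \<in> Cj j. d c = 1})) ` {j \<in> J. \<exists>c\<in>Cj j. d c = 1})"

end

theory Submission
  imports Defs
begin

text \<open>The smallest max-min fair share is the reciprocal of the largest congestion, so it suffices to
  compare largest congestions. If \<open>K\<close> is the largest congestion of \<open>P\<close>, then every ToR sends and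
  receives at most \<open>K |S|\<close> units of demand. When Greedy assigns a commodity from \<open>u\<close> to \<open>v\<close> to
  a path of congestion \<open>m\<close>, all \<open>|S|\<close> candidate paths have congestion at least \<open>m\<close>, hence the links
  leaving \<open>u\<close> and the links entering \<open>v\<close> together carry at least \<open>m |S|\<close> units. As the new
  commodity is not yet counted, this is less than \<open>2 K |S|\<close>, so \<open>m + 1 \<le> 2 K\<close>.\<close>

section \<open>Max-min fair allocations\<close>

text \<open>Capacities \<open>k\<close> vary per link, although all links of the network have
  capacity 1: water filling recurses on residual capacities. \<open>U e\<close> is the set of
  commodities using link \<open>e\<close>.\<close>

definition feasible_alloc ::
  "'c set \<Rightarrow> 'e set \<Rightarrow> ('e \<Rightarrow> 'c set) \<Rightarrow> ('e \<Rightarrow> real) \<Rightarrow> ('c \<Rightarrow> real) \<Rightarrow> bool" where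
  "feasible_alloc I E U k b \<longleftrightarrow>
     (\<forall>c\<in>I. 0 \<le> b c) \<and> (\<forall>c. c \<notin> I \<longrightarrow> b c = 0) \<and> (\<forall>e\<in>E. (\<Sum>c\<in>I \<inter> U e. b c) \<le> k e)"

definition fair_alloc ::
  "'c set \<Rightarrow> 'e set \<Rightarrow> ('e \<Rightarrow> 'c set) \<Rightarrow> ('e \<Rightarrow> real) \<Rightarrow> ('c \<Rightarrow> real) \<Rightarrow> bool" where
  "fair_alloc I E U k b \<longleftrightarrow> feasible_alloc I E U k b \<and>
     (\<forall>b'. feasible_alloc I E U k b' \<longrightarrow>
       (\<forall>c\<in>I. b' c > b c \<longrightarrow> (\<exists>c'\<in>I. b c' \<le> b c \<and> b' c' < b c')))"

text \<open>The constant rate \<open>t\<close> on \<open>I\<close> is itself feasible. If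
  \<open>b c < t\<close>, moving to it raises \<open>c\<close>, so fairness yields a loser
  \<open>c'\<close> with \<open>b c' \<le> b c < t\<close>; but \<open>c'\<close> receives
  \<open>t\<close> and does not lose.\<close>

lemma fair_alloc_ge_uniform:
  assumes fair: "fair_alloc I E U k b" and "finite I" and t: "0 \<le> t"
    and cap: "\<And>e. e \<in> E \<Longrightarrow> t * real (card (I \<inter> U e)) \<le> k e"
    and c: "c \<in> I"
  shows "t \<le> b c"
proof (rule ccontr)
  assume "\<not> t \<le> b c"
  define b' where "b' = (\<lambda>c. if c \<in> I then t else 0)"
  have "(\<Sum>c\<in>I \<inter> U e. b' c) = t * real (card (I \<inter> U e))" for e
    by (simp add: b'_def mult.commute)
  then have "(\<Sum>c\<in>I \<inter> U e. b' c) \<le> k e" if "e \<in> E" for e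
    using cap[OF that] by simp
  then have "feasible_alloc I E U k b'"
    using t unfolding feasible_alloc_def by (simp add: b'_def)
  moreover have "b' c > b c"
    using \<open>\<not> t \<le> b c\<close> c by (simp add: b'_def)
  ultimately obtain c' where "c' \<in> I" "b c' \<le> b c" "b' c' < b c'"
    using fair c unfolding fair_alloc_def by blast
  then show False
    using \<open>\<not> t \<le> b c\<close> by (simp add: b'_def)
qed

text \<open>Water filling: saturate a link \<open>e0\<close> with the smallest equal share \<open>t\<close>, and recurse on the
  commodities that avoid it, with the residual capacities.\<close>

lemma fair_alloc_exists:
  assumes "finite I" "finite E" "\<And>c. c \<in> I \<Longrightarrow> \<exists>e\<in>E. c \<in> U e" "\<And>e. e \<in> E \<Longrightarrow> 0 \<le> k e"
  shows "\<exists>b. fair_alloc I E U k b"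
  using assms
proof (induction "card I" arbitrary: I k rule: less_induct)
  case less
  show ?case
  proof (cases "I = {}")
    case True
    then have "fair_alloc I E U k (\<lambda>_. 0)"
      using less.prems by (auto simp: fair_alloc_def feasible_alloc_def)
    then show ?thesis by blast
  next
    case False
    \<comment> \<open>Links without commodities are excluded: there \<open>r\<close> would divide by
      0 and take the value 0, a spurious minimum.\<close>
    define F where "F = {e \<in> E. I \<inter> U e \<noteq> {}}"
    define r where "r e = k e / real (card (I \<inter> U e))" for e
    have F: "finite F" "F \<noteq> {}"
      using less.prems False by (auto simp: F_def)
    define e0 where "e0 = arg_min_on r F"
    have e0: "e0 \<in> F" and min: "\<And>e. e \<in> F \<Longrightarrow> r e0 \<le> r e"
      using arg_min_if_finite[OF F, of r] unfolding e0_def by (auto simp: not_less)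
    define t where "t = r e0"
    have pos: "real (card (I \<inter> U e)) > 0" if "e \<in> F" for e
      using that less.prems(1) by (auto simp: F_def card_gt_0_iff)
    have t0: "0 \<le> t"
      using e0 less.prems(4) by (simp add: t_def r_def F_def)
    have tcap: "t * real (card (I \<inter> U e)) \<le> k e" if "e \<in> E" for e
    proof (cases "e \<in> F")
      case True
      then show ?thesis using min[OF True] pos[OF True] by (simp add: t_def r_def pos_le_divide_eq)
    next
      case False
      then have "I \<inter> U e = {}" using that by (simp add: F_def)
      then show ?thesis using less.prems(4)[OF that] by simp
    qed
    have tight: "t * real (card (I \<inter> U e0)) = k e0"
      using pos[OF e0] by (simp add: t_def r_def)
    define B where "B = I \<inter> U e0"
    define I' where "I' = I - B"
    define k' where "k' e = k e - t * real (card (B \<inter> U e))" for e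
    have "B \<subseteq> I" "B \<noteq> {}" using e0 by (auto simp: B_def F_def)
    have fin: "finite B" "finite I'" using less.prems(1) by (auto simp: B_def I'_def)
    have split: "sum f (I \<inter> U e) = sum f (B \<inter> U e) + sum f (I' \<inter> U e)" for f :: "'a \<Rightarrow> real" and e
    proof -
      have "I \<inter> U e = (B \<inter> U e) \<union> (I' \<inter> U e)" using \<open>B \<subseteq> I\<close> by (auto simp: I'_def)
      then show ?thesis using fin by (simp, subst sum.union_disjoint) (auto simp: I'_def)
    qed
    \<comment> \<open>After \<open>B\<close> is served, giving \<open>t\<close> to everyone else is
      still feasible. Hence the residual capacities are nonnegative and, by
      \<open>fair_alloc_ge_uniform\<close>, no rate found by the recursion falls below
      \<open>t\<close>.\<close>
    have k'_cap: "t * real (card (I' \<inter> U e)) \<le> k' e" if "e \<in> E" for e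
      using tcap[OF that] split[of "\<lambda>_. 1" e] by (simp add: k'_def algebra_simps)
    have k'0: "0 \<le> k' e" if "e \<in> E" for e
      using k'_cap[OF that] t0 by (meson mult_nonneg_nonneg of_nat_0_le_iff order_trans)
    have "card I' < card I"
      using \<open>B \<subseteq> I\<close> \<open>B \<noteq> {}\<close> less.prems(1) by (intro psubset_card_mono) (auto simp: I'_def)
    moreover have "\<exists>e\<in>E. c \<in> U e" if "c \<in> I'" for c
      using that less.prems(3) by (auto simp: I'_def)
    ultimately obtain b where b: "fair_alloc I' E U k' b"
      using less.hyps[of I' k'] fin less.prems(2) k'0 by blast
    have bt: "t \<le> b c" if "c \<in> I'" for c
      using fair_alloc_ge_uniform[OF b fin(2) t0 k'_cap that] .
    define a where "a c = (if c \<in> B then t else b c)" for c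
    have aB: "sum a (B \<inter> U e) = t * real (card (B \<inter> U e))" for e
      by (simp add: a_def)
    have aI': "sum a (I' \<inter> U e) = sum b (I' \<inter> U e)" for e
      by (rule sum.cong) (auto simp: a_def I'_def)
    have b_feas: "feasible_alloc I' E U k' b" using b by (simp add: fair_alloc_def)
    have "feasible_alloc I E U k a"
      unfolding feasible_alloc_def
    proof (intro conjI ballI allI impI)
      fix e assume "e \<in> E"
      then show "sum a (I \<inter> U e) \<le> k e"
        using b_feas unfolding feasible_alloc_def split aB aI' by (auto simp: k'_def)
    next
      fix c assume "c \<in> I"
      then show "0 \<le> a c" using t0 b_feas by (auto simp: a_def feasible_alloc_def I'_def)
    next
      fix c assume "c \<notin> I"
      then show "a c = 0" using \<open>B \<subseteq> I\<close> b_feas by (auto simp: a_def feasible_alloc_def I'_def)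
    qed
    moreover have "\<exists>c'\<in>I. a c' \<le> a c \<and> x c' < a c'"
      if x: "feasible_alloc I E U k x" and c: "c \<in> I" and gt: "a c < x c" for x c
    \<comment> \<open>Since \<open>t\<close> is the smallest rate in \<open>a\<close>, any commodity
      of \<open>B\<close> that loses is a valid witness. If none loses, the gain must be examined
      within \<open>I'\<close>.\<close>
    proof (cases "\<exists>c'\<in>B. x c' < t")
      case True
      then obtain c' where "c' \<in> B" "x c' < t" by blast
      moreover have "t \<le> a c" using bt c by (auto simp: a_def I'_def)
      ultimately show ?thesis using \<open>B \<subseteq> I\<close> by (auto simp: a_def intro!: bexI[of _ c'])
    next
      case False
      then have xt: "t \<le> x c'" if "c' \<in> B" for c' using that by force
      \<comment> \<open>\<open>e0\<close> is saturated by \<open>a\<close> with rate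
        \<open>t\<close> for each commodity of \<open>B\<close>, so none of them can gain unless
        another one loses.\<close>
      have "c \<notin> B"
      proof
        assume "c \<in> B"
        then have "(\<Sum>c'\<in>B. t) < sum x B"
          using gt xt fin(1) by (intro sum_strict_mono_ex1) (auto simp: a_def)
        then show False
          using x e0 tight unfolding feasible_alloc_def B_def F_def by (force simp: mult.commute)
      qed
      then have c': "c \<in> I'" using c by (simp add: I'_def)
      \<comment> \<open>As \<open>x\<close> gives each commodity of \<open>B\<close> at least
        \<open>t\<close>, what it leaves for \<open>I'\<close> fits into the residual capacities,
        and fairness of \<open>b\<close> applies to this restriction.\<close>
      define y where "y c = (if c \<in> I' then x c else 0)" for c
      have "sum y (I' \<inter> U e) \<le> k' e" if "e \<in> E" for e
      proof -
        have "t * real (card (B \<inter> U e)) \<le> sum x (B \<inter> U e)"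
          using sum_mono[of "B \<inter> U e" "\<lambda>_. t" x] xt by (simp add: mult.commute)
        moreover have "sum x (I \<inter> U e) \<le> k e" using x that by (simp add: feasible_alloc_def)
        moreover have "sum y (I' \<inter> U e) = sum x (I' \<inter> U e)" by (rule sum.cong) (auto simp: y_def)
        ultimately show ?thesis using split[of x e] by (simp add: k'_def)
      qed
      then have "feasible_alloc I' E U k' y"
        using x by (auto simp: feasible_alloc_def y_def I'_def)
      moreover have "y c > b c" using gt c' \<open>c \<notin> B\<close> by (simp add: y_def a_def)
      ultimately obtain c'' where "c'' \<in> I'" "b c'' \<le> b c" "y c'' < b c''"
        using b c' unfolding fair_alloc_def by blast
      then show ?thesis using \<open>c \<notin> B\<close> by (auto simp: a_def I'_def y_def)
    qed
    ultimately have "fair_alloc I E U k a" by (auto simp: fair_alloc_def)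
    then show ?thesis by blast
  qed
qed

text \<open>Compare two fair allocations at a commodity where they differ and the smaller of the two
  rates is minimal: fairness would produce a commodity with an even smaller rate.\<close>

lemma fair_alloc_unique:
  assumes "finite I" and a: "fair_alloc I E U k a" and b: "fair_alloc I E U k b"
  shows "a = b"
proof (rule ccontr)
  assume "a \<noteq> b"
  define D where "D = {c \<in> I. a c \<noteq> b c}"
  have "D \<noteq> {}"
    using \<open>a \<noteq> b\<close> a b by (force simp: D_def fair_alloc_def feasible_alloc_def fun_eq_iff)
  moreover have "finite D" using assms(1) by (simp add: D_def)
  ultimately obtain c where c: "c \<in> D" and
    min: "\<And>c'. c' \<in> D \<Longrightarrow> min (a c) (b c) \<le> min (a c') (b c')"
    using arg_min_if_finite[of D "\<lambda>c. min (a c) (b c)"] by (metis not_less)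
  have no: False if h: "fair_alloc I E U k x" "feasible_alloc I E U k y" "x c < y c"
    "\<And>c'. c' \<in> I \<Longrightarrow> x c' \<noteq> y c' \<Longrightarrow> min (x c) (y c) \<le> min (x c') (y c')" for x y
  proof -
    obtain c' where "c' \<in> I" "x c' \<le> x c" "y c' < x c'"
      using h(1-3) c unfolding fair_alloc_def D_def by blast
    then show False using h(3) h(4)[of c'] by auto
  qed
  show False
  proof (cases "a c < b c")
    case True
    then show False using no[of a b] a b min by (auto simp: fair_alloc_def D_def)
  next
    case False
    then have "b c < a c" using c by (auto simp: D_def)
    then show False
      using no[of b a] a b min by (auto simp: fair_alloc_def D_def min.commute)
  qed
qed

lemma max_min_fair_iff_fair_alloc:
  "max_min_fair G d A = fair_alloc (active d A) (arcs G) (traversing A) (\<lambda>_. 1)"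
  by (auto simp: fun_eq_iff max_min_fair_def fair_alloc_def feasible_rates_def feasible_alloc_def)

section \<open>Bandwidth shares and congestion\<close>

text \<open>Existence and uniqueness make the definite description meaningful. The last assumption
  keeps rates bounded: a commodity on no link could raise its rate forever.\<close>

lemma bandwidth_share_max_min_fair:
  assumes "finite (active d A)" "finite (arcs G)"
    and "\<And>c. c \<in> active d A \<Longrightarrow> \<exists>e\<in>arcs G. c \<in> traversing A e"
  shows "max_min_fair G d A (bandwidth_share G d A)"
proof -
  have "\<exists>!b. max_min_fair G d A b"
    unfolding max_min_fair_iff_fair_alloc
    using fair_alloc_exists[OF assms, of "\<lambda>_. 1"] fair_alloc_unique[OF assms(1)] by auto
  then show ?thesis unfolding bandwidth_share_def by (rule theI')
qed

lemma congestion_eq_card: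
  assumes "finite (dom A)" "\<forall>c\<in>dom A. d c \<in> {0, 1}"
  shows "congestion d A e = card (active d A \<inter> traversing A e)"
proof -
  have sub: "traversing A e \<subseteq> dom A" by (auto simp: traversing_def)
  have "congestion d A e = (\<Sum>c\<in>traversing A e. if d c = 1 then 1 else 0)"
    unfolding congestion_def using assms(2) sub by (intro sum.cong) auto
  also have "\<dots> = card (active d A \<inter> traversing A e)"
    using finite_subset[OF sub assms(1)] sub
    by (subst sum.inter_filter[symmetric]) (auto simp: active_def intro!: arg_cong[where f = card])
  finally show ?thesis .
qed

text \<open>The uniform rate \<open>1 / L\<close> overloads no link of congestion at most
  \<open>L\<close>.\<close>

lemma max_min_fair_ge:
  assumes "max_min_fair G d A b" "finite (dom A)" "\<forall>c\<in>dom A. d c \<in> {0, 1}"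
    and "\<And>e. e \<in> arcs G \<Longrightarrow> congestion d A e \<le> L" "0 < L" "c \<in> active d A"
  shows "1 / real L \<le> b c"
proof (rule fair_alloc_ge_uniform[where I = "active d A" and E = "arcs G" and U = "traversing A"
      and k = "\<lambda>_. 1"])
  show "fair_alloc (active d A) (arcs G) (traversing A) (\<lambda>_. 1) b"
    using assms(1) by (simp add: max_min_fair_iff_fair_alloc)
  show "1 / real L * real (card (active d A \<inter> traversing A e)) \<le> 1" if "e \<in> arcs G" for e
    using assms(4)[OF that] assms(5) by (simp add: congestion_eq_card[OF assms(2,3)])
qed (use assms in \<open>auto simp: active_def\<close>)

text \<open>Opposite direction to \<open>max_min_fair_ge\<close>: each commodity on \<open>e\<close>
  takes at least \<open>m\<close> of its unit capacity. Feasibility alone suffices.\<close>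

lemma feasible_rates_lower_bound_mult_congestion:
  assumes "feasible_rates G d A b" "finite (dom A)" "\<forall>c\<in>dom A. d c \<in> {0, 1}"
    and "\<And>c. c \<in> active d A \<Longrightarrow> m \<le> b c" "e \<in> arcs G"
  shows "m * real (congestion d A e) \<le> 1"
proof -
  have "m * real (congestion d A e) \<le> (\<Sum>c\<in>active d A \<inter> traversing A e. b c)"
    using sum_mono[of "active d A \<inter> traversing A e" "\<lambda>_. m" b] assms(4)
    by (simp add: congestion_eq_card[OF assms(2,3)] mult.commute)
  also have "\<dots> \<le> 1" using assms(1,5) by (simp add: feasible_rates_def)
  finally show ?thesis .
qed

lemma min_job_share_eq_Min:
  assumes "finite C" "C = (\<Union>j\<in>J. Cj j)" "disjoint_family_on Cj J" "\<exists>c\<in>C. d c = 1"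
  shows "min_job_share J Cj d b = Min (b ` {c \<in> C. d c = 1})"
proof -
  define J' where "J' = {j \<in> J. \<exists>c\<in>Cj j. d c = 1}"
  define X where "X j = {c \<in> Cj j. d c = 1}" for j
  have XU: "{c \<in> C. d c = 1} = (\<Union>j\<in>J'. X j)" using assms(2) by (auto simp: J'_def X_def)
  have "finite J'"
  \<comment> \<open>\<open>J\<close> may be infinite, while \<open>Min\<close> is meaningful only on
    finite sets. The sets \<open>X j\<close> with \<open>j\<close> in \<open>J'\<close> are nonempty
    and pairwise disjoint, so \<open>X\<close> embeds \<open>J'\<close> into the finite
    \<open>Pow C\<close>.\<close>
  proof (rule inj_on_finite)
    show "inj_on X J'"
      using assms(3) unfolding inj_on_def disjoint_family_on_def J'_def X_def by blast
    show "X ` J' \<subseteq> Pow C" using assms(2) by (auto simp: J'_def X_def)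
    show "finite (Pow C)" using assms(1) by simp
  qed
  have X: "finite (X j)" "X j \<noteq> {}" if "j \<in> J'" for j
    using that assms(1,2) by (auto simp: J'_def X_def intro: finite_subset[of _ C])
  have J': "J' \<noteq> {}" using assms(2,4) by (auto simp: J'_def)
  have fin: "finite {c \<in> C. d c = 1}" using assms(1) by simp
  have "Min ((\<lambda>j. Min (b ` X j)) ` J') = Min (b ` {c \<in> C. d c = 1})"
  proof (rule Min_eqI)
    show "finite ((\<lambda>j. Min (b ` X j)) ` J')" using \<open>finite J'\<close> by simp
    show "Min (b ` {c \<in> C. d c = 1}) \<le> y" if "y \<in> (\<lambda>j. Min (b ` X j)) ` J'" for y
      using that X fin XU by (auto intro!: Min_antimono)
    have "Min (b ` {c \<in> C. d c = 1}) \<in> b ` {c \<in> C. d c = 1}"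
      using fin assms(4) by (intro Min_in) auto
    then obtain j c where jc: "j \<in> J'" "c \<in> X j" "Min (b ` {c \<in> C. d c = 1}) = b c"
      using XU by auto
    have "Min (b ` X j) = b c"
    proof (rule Min_eqI)
      show "b c \<le> y" if "y \<in> b ` X j" for y
        unfolding jc(3)[symmetric] using that XU fin jc(1) by (intro Min_le) auto
    qed (use X jc in auto)
    then show "Min (b ` {c \<in> C. d c = 1}) \<in> (\<lambda>j. Min (b ` X j)) ` J'"
      using jc by force
  qed
  then show ?thesis by (simp add: min_job_share_def J'_def X_def)
qed

section \<open>Congestion in a Clos network\<close>

locale clos_commodities =
  fixes T S :: "'v set" and C :: "'c set" and src dst :: "'c \<Rightarrow> 'v" and d :: "'c \<Rightarrow> nat"
  assumes finite_S: "finite S" and S_nonempty: "S \<noteq> {}" and disjoint: "T \<inter> S = {}"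
    and finite_C: "finite C"
    and endpoints: "c \<in> C \<Longrightarrow> src c \<in> T \<and> dst c \<in> T \<and> src c \<noteq> dst c"
    and demands: "c \<in> C \<Longrightarrow> d c \<in> {0, 1}"
begin

abbreviation "net \<equiv> clos_network T S"

lemma shortest_paths_commodity:
  "c \<in> C \<Longrightarrow> shortest_paths net (src c) (dst c) = (\<lambda>s. [(src c, s), (s, dst c)]) ` S"
  using shortest_paths_clos_network[OF disjoint S_nonempty] endpoints by blast

text \<open>Stated for a subset \<open>X\<close> of \<open>C\<close>, so that it also covers the
  intermediate states of a Greedy run.\<close>

lemma path_assignmentE:
  assumes "path_assignment net X src dst A" "X \<subseteq> C" "c \<in> X"
  obtains s where "s \<in> S" "A c = Some [(src c, s), (s, dst c)]"
proof -
  have "c \<in> C" "c \<in> dom A" "the (A c) \<in> shortest_paths net (src c) (dst c)"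
    using assms by (auto simp: path_assignment_def)
  then show thesis using that by (force simp: shortest_paths_commodity)
qed

text \<open>As \<open>T\<close> and \<open>S\<close> are disjoint, a link leaving a ToR can only be
  the first link of an assigned path. For fixed \<open>u\<close>, the sets for distinct spines are
  therefore disjoint.\<close>

lemma traversing_out:
  assumes "path_assignment net X src dst A" "X \<subseteq> C" "u \<in> T"
  shows "traversing A (u, s) = {c \<in> X. src c = u \<and> A c = Some [(u, s), (s, dst c)]}" (is "?l = ?r")
proof
  show "?l \<subseteq> ?r"
  proof
    fix c assume c: "c \<in> ?l"
    then have "c \<in> X" using assms(1) by (auto simp: path_assignment_def traversing_def)
    with assms obtain s' where "s' \<in> S" "A c = Some [(src c, s'), (s', dst c)]"
      by (elim path_assignmentE)
    then show "c \<in> ?r" using c \<open>c \<in> X\<close> assms(3) disjoint by (auto simp: traversing_def)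
  qed
qed (auto simp: traversing_def)

lemma traversing_in:
  assumes "path_assignment net X src dst A" "X \<subseteq> C" "v \<in> T"
  shows "traversing A (s, v) = {c \<in> X. dst c = v \<and> A c = Some [(src c, s), (s, v)]}" (is "?l = ?r")
proof
  show "?l \<subseteq> ?r"
  proof
    fix c assume c: "c \<in> ?l"
    then have "c \<in> X" using assms(1) by (auto simp: path_assignment_def traversing_def)
    with assms obtain s' where "s' \<in> S" "A c = Some [(src c, s'), (s', dst c)]"
      by (elim path_assignmentE)
    then show "c \<in> ?r" using c \<open>c \<in> X\<close> assms(3) disjoint by (auto simp: traversing_def)
  qed
qed (auto simp: traversing_def)

text \<open>Each path from \<open>u\<close> uses exactly one of its outgoing links. The total
  depends only on the demands of \<open>X\<close>, not on the routing, which is what lets two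
  different assignments be compared.\<close>

lemma sum_congestion_out:
  assumes "path_assignment net X src dst A" "X \<subseteq> C" "u \<in> T"
  shows "(\<Sum>s\<in>S. congestion d A (u, s)) = (\<Sum>c | c \<in> X \<and> src c = u. d c)"
proof -
  have "{c \<in> X. src c = u} = (\<Union>s\<in>S. traversing A (u, s))"
    unfolding traversing_out[OF assms]
    by (auto elim: path_assignmentE[OF assms(1,2)])
  moreover have "finite X" using assms(2) finite_C by (rule finite_subset)
  ultimately show ?thesis
    unfolding congestion_def
    by (simp, subst sum.UNION_disjoint) (auto simp: finite_S traversing_out[OF assms])
qed

lemma sum_congestion_in:
  assumes "path_assignment net X src dst A" "X \<subseteq> C" "v \<in> T"
  shows "(\<Sum>s\<in>S. congestion d A (s, v)) = (\<Sum>c | c \<in> X \<and> dst c = v. d c)"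
proof -
  have "{c \<in> X. dst c = v} = (\<Union>s\<in>S. traversing A (s, v))"
    unfolding traversing_in[OF assms]
    by (auto elim: path_assignmentE[OF assms(1,2)])
  moreover have "finite X" using assms(2) finite_C by (rule finite_subset)
  ultimately show ?thesis
    unfolding congestion_def
    by (simp, subst sum.UNION_disjoint) (auto simp: finite_S traversing_in[OF assms])
qed

section \<open>Congestion along a run of Greedy\<close>

lemma path_assignment_extend:
  assumes "path_assignment net X src dst A" "p \<in> shortest_paths net (src c) (dst c)"
  shows "path_assignment net (insert c X) src dst (A(c \<mapsto> p))"
  using assms by (auto simp: path_assignment_def)

lemma greedy_run_path_assignment:
  "greedy_run net src dst d cs A \<Longrightarrow> path_assignment net (set cs) src dst A"
proof (induction rule: greedy_run.induct)
  case start
  then show ?case by (simp add: path_assignment_def)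
next
  case (assign cs A c p)
  then show ?case using path_assignment_extend by (simp add: is_arg_min_def del: fun_upd_apply)
qed

lemma congestion_assign_le:
  assumes "finite (dom A)" "A c = None"
  shows "congestion d (A(c \<mapsto> p)) e \<le> congestion d A e + (if e \<in> set p then d c else 0)"
proof -
  have fin: "finite (traversing A e)"
    by (rule finite_subset[OF _ assms(1)]) (auto simp: traversing_def)
  have "traversing (A(c \<mapsto> p)) e = (if e \<in> set p then insert c (traversing A e) else traversing A e)"
    using assms(2) by (auto simp: traversing_def)
  moreover have "c \<notin> traversing A e" using assms(2) by (simp add: traversing_def)
  ultimately show ?thesis using fin by (simp add: congestion_def)
qed

lemma path_congestion_argmin_less:
  assumes A: "path_assignment net X src dst A" and X: "X \<subseteq> C" and c: "c \<in> C" "c \<notin> X" "d c = 1"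
    and p: "is_arg_min (path_congestion d A) (\<lambda>p. p \<in> shortest_paths net (src c) (dst c)) p"
    and out: "(\<Sum>c' | c' \<in> C \<and> src c' = src c. d c') \<le> K * card S"
    and into: "(\<Sum>c' | c' \<in> C \<and> dst c' = dst c. d c') \<le> K * card S"
  shows "path_congestion d A p < 2 * K"
proof -
  let ?m = "path_congestion d A p"
  have T: "src c \<in> T" "dst c \<in> T" using endpoints c by auto
  \<comment> \<open>Strict because \<open>c\<close> has demand 1 and is counted in \<open>C\<close>
    but not yet in \<open>X\<close>.\<close>
  have less: "(\<Sum>c' | c' \<in> X \<and> f c' = f c. d c') < (\<Sum>c' | c' \<in> C \<and> f c' = f c. d c')"
    for f :: "'c \<Rightarrow> 'v"
    using finite_C X c by (intro sum_strict_mono2[where b = c]) auto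
  have "?m \<le> congestion d A (src c, s) + congestion d A (s, dst c)" if "s \<in> S" for s
  proof -
    have "[(src c, s), (s, dst c)] \<in> shortest_paths net (src c) (dst c)"
      using that c by (simp add: shortest_paths_commodity)
    then have "?m \<le> path_congestion d A [(src c, s), (s, dst c)]"
      using p by (auto simp: is_arg_min_linorder)
    \<comment> \<open>The maximum over the two links is at most their sum; this costs the factor
      2.\<close>
    then show ?thesis by (simp add: path_congestion_def)
  qed
  then have "(\<Sum>s\<in>S. ?m) \<le> (\<Sum>s\<in>S. congestion d A (src c, s) + congestion d A (s, dst c))"
    by (intro sum_mono) auto
  also have "\<dots> = (\<Sum>c' | c' \<in> X \<and> src c' = src c. d c') + (\<Sum>c' | c' \<in> X \<and> dst c' = dst c. d c')"
    using sum_congestion_out[OF A X T(1)] sum_congestion_in[OF A X T(2)]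
    by (simp add: sum.distrib)
  also have "\<dots> < 2 * K * card S" using less[of src] less[of dst] out into by linarith
  finally show ?thesis by (simp add: mult.commute)
qed

lemma greedy_congestion_le:
  assumes "greedy_run net src dst d cs A" "distinct cs" "set cs \<subseteq> C"
    and out: "\<And>u. u \<in> T \<Longrightarrow> (\<Sum>c | c \<in> C \<and> src c = u. d c) \<le> K * card S"
    and into: "\<And>v. v \<in> T \<Longrightarrow> (\<Sum>c | c \<in> C \<and> dst c = v. d c) \<le> K * card S"
  shows "congestion d A e \<le> 2 * K"
  using assms(1-3)
proof (induction arbitrary: e rule: greedy_run.induct)
  case start
  then show ?case by (simp add: congestion_def traversing_def)
next
  case (assign cs A c p)
  have A: "path_assignment net (set cs) src dst A"
    using assign.hyps(1) by (rule greedy_run_path_assignment)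
  have c: "c \<in> C" "c \<notin> set cs" "set cs \<subseteq> C" using assign.prems by auto
  have dom: "dom A = set cs" using A by (simp add: path_assignment_def)
  have IH: "congestion d A e \<le> 2 * K" using assign.IH assign.prems by simp
  have step: "congestion d (A(c \<mapsto> p)) e \<le> congestion d A e + (if e \<in> set p then d c else 0)"
    by (rule congestion_assign_le) (use dom c in auto)
  show ?case
  proof (cases "e \<in> set p \<and> d c = 1")
    case True
    have "congestion d A e \<le> path_congestion d A p"
      using True by (simp add: path_congestion_def)
    \<comment> \<open>Strictness leaves room for the one unit that \<open>c\<close> adds, so the
      bound stays \<open>2 * K\<close>.\<close>
    also have "\<dots> < 2 * K"
      using path_congestion_argmin_less[OF A c(3,1,2) _ assign.hyps(2)] True out into endpoints c
      by blast
    finally show ?thesis using step True by (simp del: fun_upd_apply)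
  next
    case False
    then show ?thesis using step IH demands[OF c(1)] by (auto simp del: fun_upd_apply split: if_splits)
  qed
qed

text \<open>Every ToR has \<open>card S\<close> outgoing and \<open>card S\<close> incoming links,
  each of congestion at most \<open>K\<close> under \<open>P\<close>. This bounds the demand it
  sends and the demand it receives.\<close>

lemma greedy_congestion_le_twice:
  assumes "greedy_run net src dst d cs A" "distinct cs" "set cs = C"
    and P: "path_assignment net C src dst P"
    and K: "\<And>e. e \<in> arcs net \<Longrightarrow> congestion d P e \<le> K"
  shows "congestion d A e \<le> 2 * K"
proof (rule greedy_congestion_le[OF assms(1,2)])
  show "(\<Sum>c | c \<in> C \<and> src c = u. d c) \<le> K * card S" if "u \<in> T" for u
    using sum_bounded_above[of S "\<lambda>s. congestion d P (u, s)" K] K that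
    by (simp add: sum_congestion_out[OF P _ that, symmetric] clos_network_def mult.commute)
  show "(\<Sum>c | c \<in> C \<and> dst c = v. d c) \<le> K * card S" if "v \<in> T" for v
    using sum_bounded_above[of S "\<lambda>s. congestion d P (s, v)" K] K that
    by (simp add: sum_congestion_in[OF P _ that, symmetric] clos_network_def mult.commute)
qed (use assms(3) in auto)

lemma bandwidth_share_fair:
  assumes "finite T" "path_assignment net C src dst A"
  shows "max_min_fair net d A (bandwidth_share net d A)"
proof (rule bandwidth_share_max_min_fair)
  have dom: "dom A = C" using assms(2) by (simp add: path_assignment_def)
  show "finite (active d A)" using finite_C by (simp add: active_def dom)
  show "finite (arcs net)" using assms(1) finite_S by (simp add: clos_network_def)
  fix c assume "c \<in> active d A"
  then have "c \<in> C" using dom by (simp add: active_def)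
  with assms(2) obtain s where "s \<in> S" "A c = Some [(src c, s), (s, dst c)]"
    by (rule path_assignmentE[OF _ subset_refl])
  then show "\<exists>e\<in>arcs net. c \<in> traversing A e"
    using endpoints[OF \<open>c \<in> C\<close>]
    by (intro bexI[of _ "(src c, s)"]) (auto simp: traversing_def clos_network_def)
qed

end

theorem theorem1:
  fixes T S :: "'v set"
    and C :: "'c set" and src dst :: "'c \<Rightarrow> 'v" and d :: "'c \<Rightarrow> nat"
    and J :: "'j set" and Cj :: "'j \<Rightarrow> 'c set"
    and cs :: "'c list" and PGr P :: "('c, 'v \<times> 'v) assignment"
  defines "G \<equiv> clos_network T S"
  assumes "finite T" "T \<noteq> {}" "finite S" "S \<noteq> {}" "T \<inter> S = {}"
    and "finite C"
    and "\<forall>c\<in>C. src c \<in> T \<and> dst c \<in> T \<and> src c \<noteq> dst c"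
    and "\<forall>c\<in>C. d c \<in> {0, 1}" "\<exists>c\<in>C. d c = 1"
    and "C = (\<Union>j\<in>J. Cj j)" "disjoint_family_on Cj J"
    and "distinct cs" "set cs = C"
    and "greedy_run G src dst d cs PGr"
    and "path_assignment G C src dst P"
  shows "min_job_share J Cj d (bandwidth_share G d PGr)
           \<ge> 1 / 2 * min_job_share J Cj d (bandwidth_share G d P)"
proof -
  interpret clos_commodities T S C src dst d
    by unfold_locales (use assms in blast)+
  note P = \<open>path_assignment G C src dst P\<close>
  note run = \<open>greedy_run G src dst d cs PGr\<close>
  have Gr: "path_assignment G C src dst PGr"
    using greedy_run_path_assignment[OF run[unfolded G_def]] \<open>set cs = C\<close> by (simp add: G_def)
  have dom: "dom P = C" "dom PGr = C" using P Gr by (simp_all add: path_assignment_def)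
  have act: "active d P = {c \<in> C. d c = 1}" "active d PGr = {c \<in> C. d c = 1}"
    by (simp_all add: active_def dom)
  have fin: "finite (dom P)" "finite (dom PGr)" using finite_C dom by simp_all
  have dem: "\<forall>c\<in>dom P. d c \<in> {0, 1}" "\<forall>c\<in>dom PGr. d c \<in> {0, 1}" using demands dom by auto
  define b where "b = bandwidth_share G d P"
  define g where "g = bandwidth_share G d PGr"
  have b: "max_min_fair G d P b" and g: "max_min_fair G d PGr g"
    using bandwidth_share_fair[OF \<open>finite T\<close>] P Gr by (auto simp: b_def g_def G_def)
  define D where "D = {c \<in> C. d c = 1}"
  have D: "finite D" "D \<noteq> {}" using finite_C \<open>\<exists>c\<in>C. d c = 1\<close> by (auto simp: D_def)
  define m where "m = Min (b ` D)"
  have arcs: "finite (arcs G)" "arcs G \<noteq> {}"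
    using \<open>finite T\<close> \<open>finite S\<close> \<open>T \<noteq> {}\<close> \<open>S \<noteq> {}\<close> by (auto simp: G_def clos_network_def)
  define K where "K = Max (congestion d P ` arcs G)"
  have K: "congestion d P e \<le> K" if "e \<in> arcs G" for e
    using that arcs by (simp add: K_def)
  obtain e where e: "e \<in> arcs G" "K = congestion d P e"
    using Max_in[of "congestion d P ` arcs G"] arcs unfolding K_def by blast
  have le: "congestion d PGr e \<le> 2 * K" for e
    using greedy_congestion_le_twice[OF _ \<open>distinct cs\<close> \<open>set cs = C\<close>] run P K
    by (simp add: G_def)
  have mK: "m * real K \<le> 1"
    unfolding e(2)
  proof (rule feasible_rates_lower_bound_mult_congestion[OF _ fin(1) dem(1) _ e(1)])
    show "feasible_rates G d P b" using b by (simp add: max_min_fair_def)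
    show "m \<le> b c" if "c \<in> active d P" for c using that D act by (simp add: m_def D_def)
  qed
  \<comment> \<open>Positivity permits dividing by \<open>K\<close>; the first link of any demand-1
    commodity has positive congestion under \<open>P\<close>.\<close>
  have "K > 0"
  proof -
    obtain c where c: "c \<in> C" "d c = 1" using \<open>\<exists>c\<in>C. d c = 1\<close> by blast
    obtain s where s: "s \<in> S" "P c = Some [(src c, s), (s, dst c)]"
      using path_assignmentE[OF P[unfolded G_def] subset_refl c(1)] .
    have "c \<in> active d P \<inter> traversing P (src c, s)"
      using c s dom by (auto simp: active_def traversing_def)
    moreover have "finite (active d P \<inter> traversing P (src c, s))" using fin by (simp add: active_def)
    ultimately have "congestion d P (src c, s) > 0"
      by (auto simp: congestion_eq_card[OF fin(1) dem(1)] card_gt_0_iff)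
    moreover have "(src c, s) \<in> arcs G" using s endpoints[OF c(1)] by (simp add: G_def clos_network_def)
    ultimately show ?thesis using K by (meson less_le_trans)
  qed
  have "m / 2 \<le> 1 / real (2 * K)" using mK \<open>K > 0\<close> by (simp add: field_simps)
  also have "1 / real (2 * K) \<le> Min (g ` D)"
  proof (rule Min.boundedI)
    fix y assume "y \<in> g ` D"
    then show "1 / real (2 * K) \<le> y"
      using max_min_fair_ge[OF g fin(2) dem(2) le] \<open>K > 0\<close> act by (auto simp: D_def)
  qed (use D in auto)
  finally show ?thesis
    using min_job_share_eq_Min[OF \<open>finite C\<close> \<open>C = (\<Union>j\<in>J. Cj j)\<close> \<open>disjoint_family_on Cj J\<close>
        \<open>\<exists>c\<in>C. d c = 1\<close>]
    by (simp add: m_def b_def g_def D_def)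
qed

end
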